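(* Let $K\ge 1$, $\mathcal K=\{1,\dots,K\}$, let $\mathcal N\subseteq\mathcal K$ be the set of indices of true null hypotheses, $K_0=|\mathcal N|$, and let $\mathbf P=(P_1,\dots,P_K)$ be a random vector of p-values, with an arbitrary joint distribution, such that $P_k$ is a p-variable for every $k\in\mathcal N$. Let $\alpha\in(0,1)$, let $\mathcal D$ be the Benjamini-Hochberg (BH) procedure at level $\alpha$ applied to $\mathbf P$, and let $\ell_K=\sum_{k=1}^K\frac1k$. Then $$\mathrm{FDR}_{\mathcal D}=\mathbb E\left[\frac{F_{\mathcal D}}{R_{\mathcal D}\vee 1}\right]\le\frac{\ell_K\,\alpha K_0}{K}.$$
   Context: Hypotheses $H_1,\dots,H_K$ are tested; $\mathcal N\subseteq\mathcal K$ is the (deterministic) set of indices of the true null hypotheses. For each $k\in\mathcal K$, $P_k$ is a $[0,\infty)$-valued random variable (the p-value of $H_k$). A p-variable is a random variable $P$ with $\mathbb P(P\le t)\le t$ for all $t\in(0,1)$. The p-values with $k\notin\mathcal N$ need not be p-variables. A testing procedure is a map $\mathcal D:[0,\infty)^K\to 2^{\mathcal K}$ that takes the p-values as input and returns the set of indices of rejected hypotheses. $\mathcal D$ is identified with its random output $\mathcal D(\mathbf P)$. $R_{\mathcal D}=|\mathcal D|$ is the number of discoveries and $F_{\mathcal D}=|\mathcal D\cap\mathcal N|$ is the number of false discoveries. The false discovery rate is $\mathrm{FDR}_{\mathcal D}=\mathbb E[F_{\mathcal D}/(R_{\mathcal D}\vee 1)]$; here $x\vee y=\max(x,y)$. BH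 procedure at level $\alpha$: for input $(p_1,\dots,p_K)$ let $p_{(1)}\le\dots\le p_{(K)}$ be the order statistics from smallest to largest and let $$k^*=\max\left\{k\in\mathcal K:\frac{K p_{(k)}}{k}\le\alpha\right\},\qquad \max(\varnothing)=0.$$ The procedure rejects the hypotheses with the $k^*$ smallest p-values and accepts the rest, i.e. the output is $\{k\in\mathcal K: p_k\le p_{(k^* )}\}$ if $k^*\ge 1$ and $\varnothing$ if $k^*=0$ (by maximality of $k^*$ there is no tie between $p_{(k^* )}$ and $p_{(k^*+1)}$). *)

theory Defs
  imports "HOL-Probability.Probability"
begin

definition p_variable :: "'a measure \<Rightarrow> ('a \<Rightarrow> real) \<Rightarrow> bool" where
  "p_variable M X \<longleftrightarrow>
     X \<in> borel_measurable M \<and> (\<forall>t\<in>{0<..<1}. measure M {\<omega> \<in> space M. X \<omega> \<le> t} \<le> t)"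

text \<open>
  A vector of \<open>K\<close> p-values is a function \<open>p :: nat \<Rightarrow> real\<close> of which only the values on the
  index set \<open>{1..K}\<close> are used.
\<close>

text \<open>The order statistic \<open>p\<^sub>(\<^sub>k\<^sub>)\<close>, meaningful for \<open>k \<in> {1..K}\<close>; lists are indexed from 0.\<close>

definition order_stat :: "nat \<Rightarrow> (nat \<Rightarrow> real) \<Rightarrow> nat \<Rightarrow> real" where
  "order_stat K p k = sort (map p [1..<Suc K]) ! (k - 1)"

text \<open>Inserting \<open>0\<close> implements the convention \<open>max(\<emptyset>) = 0\<close>.\<close>

definition bh_index :: "nat \<Rightarrow> real \<Rightarrow> (nat \<Rightarrow> real) \<Rightarrow> nat" where
  "bh_index K \<alpha> p =
     Max (insert 0 {k \<in> {1..K}. real K * order_stat K p k / real k \<le> \<alpha>})"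

definition benjamini_hochberg :: "nat \<Rightarrow> real \<Rightarrow> (nat \<Rightarrow> real) \<Rightarrow> nat set" where
  "benjamini_hochberg K \<alpha> p =
     (if bh_index K \<alpha> p = 0 then {}
      else {k \<in> {1..K}. p k \<le> order_stat K p (bh_index K \<alpha> p)})"

text \<open>
  False discovery rate of a testing procedure \<open>D\<close> applied to the random p-values \<open>P\<close>, where
  \<open>N\<close> is the set of indices of the true null hypotheses.
\<close>

definition FDR ::
    "'a measure \<Rightarrow> nat set \<Rightarrow> ((nat \<Rightarrow> real) \<Rightarrow> nat set) \<Rightarrow> (nat \<Rightarrow> 'a \<Rightarrow> real) \<Rightarrow> real" where
  "FDR M N D P =
     prob_space.expectation M
       (\<lambda>\<omega>. real (card (D (\<lambda>k. P k \<omega>) \<inter> N)) / real (max (card (D (\<lambda>k. P k \<omega>))) 1))"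

end

theory Submission
  imports Defs
begin

text \<open>
  The obstacle is that the number \<open>R\<close> of discoveries in the denominator depends on all p-values,
  whose joint distribution is arbitrary. The idea is to decouple it from each single p-value.
  A rejected hypothesis \<open>k\<close> satisfies \<open>p\<^sub>k \<le> \<alpha> R / K\<close> (lemma \<open>benjamini_hochberg_self_consistent\<close>).
  Writing \<open>1 / R\<close> as the tail sum \<open>\<Sum>j=R..K. w\<^sub>j\<close> of nonnegative weights, the contribution of
  \<open>k\<close> to the false discovery proportion is therefore at most \<open>\<Sum>j=1..K. w\<^sub>j * 1{p\<^sub>k \<le> \<alpha> j / K}\<close>:
  every threshold with \<open>j \<ge> R\<close> lies above \<open>p\<^sub>k\<close>. This bound involves \<open>p\<^sub>k\<close> alone, so dependence no
  longer matters, and for a p-variable its expectation is at most \<open>\<alpha> / K * (\<Sum>j=1..K. j * w\<^sub>j)\<close>.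
  Summation by parts turns the last sum into the harmonic number, the sum over \<open>i\<close> of the tail
  sums \<open>1 / i\<close>. Adding the bounds over the true nulls gives the theorem.
\<close>

text \<open>
  The decrements of \<open>1 / j\<close>, where the function drops to \<open>0\<close> after \<open>K\<close>; the tail sums then
  telescope to exactly \<open>1 / j\<close>.
\<close>

definition reciprocal_decrement :: "nat \<Rightarrow> nat \<Rightarrow> real" where
  "reciprocal_decrement K j = (if j = K then 1 / real K else 1 / real j - 1 / real (Suc j))"

lemma reciprocal_decrement_nonneg:
  assumes "1 \<le> j"
  shows "0 \<le> reciprocal_decrement K j"
  using assms by (simp add: reciprocal_decrement_def frac_le)

lemma reciprocal_decrement_tail_sum:
  assumes "1 \<le> r" "r \<le> K"
  shows "(\<Sum>j=r..K. reciprocal_decrement K j) = 1 / real r"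
proof -
  have "(\<Sum>j=r..K. reciprocal_decrement K j)
      = (\<Sum>j=r..<K. reciprocal_decrement K j) + 1 / real K"
    using assms by (simp add: reciprocal_decrement_def flip: atLeastLessThanSuc_atLeastAtMost)
  also have "(\<Sum>j=r..<K. reciprocal_decrement K j)
      = - (\<Sum>j=r..<K. 1 / real (Suc j) - 1 / real j)"
    unfolding sum_negf[symmetric] by (rule sum.cong) (auto simp: reciprocal_decrement_def)
  also have "\<dots> = 1 / real r - 1 / real K"
    using sum_Suc_diff'[OF assms(2), of "\<lambda>j. 1 / real j"] by simp
  finally show ?thesis by simp
qed

lemma reciprocal_decrement_weighted_sum:
  "(\<Sum>j=1..K. real j * reciprocal_decrement K j) = (\<Sum>i=1..K. 1 / real i)"
proof -
  have "(\<Sum>j=1..K. real j * reciprocal_decrement K j)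
      = (\<Sum>j=1..K. \<Sum>i | i \<in> {1..K} \<and> i \<le> j. reciprocal_decrement K j)"
  proof (rule sum.cong)
    fix j assume "j \<in> {1..K}"
    then have "{i. i \<in> {1..K} \<and> i \<le> j} = {1..j}" by auto
    then show "real j * reciprocal_decrement K j
        = (\<Sum>i | i \<in> {1..K} \<and> i \<le> j. reciprocal_decrement K j)"
      by simp
  qed simp
  also have "\<dots> = (\<Sum>i=1..K. \<Sum>j | j \<in> {1..K} \<and> i \<le> j. reciprocal_decrement K j)"
    by (rule sum.swap_restrict) auto
  also have "\<dots> = (\<Sum>i=1..K. 1 / real i)"
  proof (rule sum.cong)
    fix i assume i: "i \<in> {1..K}"
    then have "{j. j \<in> {1..K} \<and> i \<le> j} = {i..K}" by auto
    with i show "(\<Sum>j | j \<in> {1..K} \<and> i \<le> j. reciprocal_decrement K j) = 1 / real i"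
      by (simp add: reciprocal_decrement_tail_sum)
  qed simp
  finally show ?thesis .
qed

text \<open>
  The first \<open>m\<close> entries of the sorted list are all at most \<open>p\<^sub>(\<^sub>m\<^sub>)\<close>; ties can only
  add to the count.
\<close>

lemma order_stat_card_le:
  assumes "1 \<le> m" "m \<le> K"
  shows "m \<le> card {k \<in> {1..K}. p k \<le> order_stat K p m}"
proof -
  define x where "x = order_stat K p m"
  define ys where "ys = sort (map p [1..<Suc K])"
  have len: "length ys = K" by (simp add: ys_def)
  have "\<forall>y \<in> set (take m ys). y \<le> x"
  proof
    fix y assume "y \<in> set (take m ys)"
    then obtain i where "i < m" "y = ys ! i"
      using assms len by (auto simp: in_set_conv_nth)
    then show "y \<le> x"
      using assms len unfolding x_def order_stat_def ys_def[symmetric]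
      by (auto intro!: sorted_nth_mono simp: ys_def)
  qed
  then have "m = length (filter (\<lambda>y. y \<le> x) (take m ys))"
    using assms len by simp
  also have "\<dots> \<le> length (filter (\<lambda>y. y \<le> x) (take m ys @ drop m ys))"
    unfolding filter_append by simp
  also have "\<dots> = size (mset (filter (\<lambda>y. y \<le> x) ys))"
    by (simp only: append_take_drop_id size_mset)
  also have "\<dots> = size (mset (filter (\<lambda>y. y \<le> x) (map p [1..<Suc K])))"
    by (simp only: ys_def mset_filter mset_sort)
  also have "\<dots> = length (filter (\<lambda>k. p k \<le> x) [1..<Suc K])"
    by (simp only: size_mset filter_map length_map o_def)
  also have "\<dots> = card (set (filter (\<lambda>k. p k \<le> x) [1..<Suc K]))"
    by (rule distinct_card[symmetric]) simp
  also have "set (filter (\<lambda>k. p k \<le> x) [1..<Suc K]) = {k \<in> {1..K}. p k \<le> x}"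
    by auto
  finally show ?thesis by (simp add: x_def)
qed

lemma benjamini_hochberg_subset: "benjamini_hochberg K \<alpha> p \<subseteq> {1..K}"
  by (auto simp: benjamini_hochberg_def)

text \<open>
  Rejected p-values are at most \<open>p\<^sub>(\<^sub>m\<^sub>) \<le> \<alpha> m / K\<close> with \<open>m\<close> the index chosen by the procedure, and
  at least \<open>m\<close> hypotheses are rejected.
\<close>

lemma benjamini_hochberg_self_consistent:
  assumes "0 \<le> \<alpha>" and k: "k \<in> benjamini_hochberg K \<alpha> p"
  shows "p k \<le> \<alpha> * real (card (benjamini_hochberg K \<alpha> p)) / real K"
proof -
  define m where "m = bh_index K \<alpha> p"
  have m0: "m \<noteq> 0"
    using k by (auto simp: benjamini_hochberg_def m_def split: if_splits)
  have D: "benjamini_hochberg K \<alpha> p = {k \<in> {1..K}. p k \<le> order_stat K p m}"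
    using m0 by (simp add: benjamini_hochberg_def m_def)
  have "m \<in> insert 0 {k \<in> {1..K}. real K * order_stat K p k / real k \<le> \<alpha>}"
    unfolding m_def bh_index_def by (rule Max_in) auto
  with m0 have m: "1 \<le> m" "m \<le> K" and thr: "real K * order_stat K p m / real m \<le> \<alpha>"
    by auto
  have "p k \<le> order_stat K p m" using k D by auto
  also have "\<dots> \<le> \<alpha> * real m / real K"
    using thr m by (simp add: field_simps)
  also have "\<dots> \<le> \<alpha> * real (card (benjamini_hochberg K \<alpha> p)) / real K"
    using order_stat_card_le[OF m, of p] assms(1)
    by (intro divide_right_mono mult_left_mono) (auto simp: D)
  finally show ?thesis .
qed

text \<open>
  Both the false discovery proportion and its denominator \<open>R\<close> depend on the whole vector, but the
  bound is a sum of functions of one coordinate each.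
\<close>

lemma false_discovery_proportion_le:
  assumes "0 \<le> \<alpha>" "finite N"
  shows "real (card (benjamini_hochberg K \<alpha> p \<inter> N)) / real (max (card (benjamini_hochberg K \<alpha> p)) 1)
    \<le> (\<Sum>k\<in>N. \<Sum>j=1..K. reciprocal_decrement K j * of_bool (p k \<le> \<alpha> * real j / real K))"
    (is "real (card (?D \<inter> N)) / _ \<le> (\<Sum>k\<in>N. ?g k)")
proof -
  define r where "r = card ?D"
  have g_nonneg: "0 \<le> ?g k" for k
    by (intro sum_nonneg mult_nonneg_nonneg reciprocal_decrement_nonneg) auto
  have finD: "finite ?D"
    by (rule finite_subset[OF benjamini_hochberg_subset]) simp
  have "1 / real (max r 1) \<le> ?g k" if k: "k \<in> ?D" for k
  proof -
    have r: "1 \<le> r" "r \<le> K"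
      using k finD card_mono[OF _ benjamini_hochberg_subset, of K \<alpha> p]
      by (auto simp: r_def Suc_le_eq card_gt_0_iff)
    have below: "p k \<le> \<alpha> * real j / real K" if "r \<le> j" for j
    proof -
      have "p k \<le> \<alpha> * real r / real K"
        unfolding r_def by (rule benjamini_hochberg_self_consistent[OF assms(1) k])
      also have "\<dots> \<le> \<alpha> * real j / real K"
        using that assms(1) by (intro divide_right_mono mult_left_mono) auto
      finally show ?thesis .
    qed
    have "1 / real (max r 1) = (\<Sum>j=r..K. reciprocal_decrement K j)"
      using r by (simp add: reciprocal_decrement_tail_sum)
    also have "\<dots> = (\<Sum>j=r..K. reciprocal_decrement K j * of_bool (p k \<le> \<alpha> * real j / real K))"
      by (rule sum.cong) (auto simp: below)
    also have "\<dots> \<le> ?g k"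
      using r by (intro sum_mono2) (auto intro!: mult_nonneg_nonneg reciprocal_decrement_nonneg)
    finally show ?thesis .
  qed
  then have "(\<Sum>k\<in>?D \<inter> N. 1 / real (max r 1)) \<le> (\<Sum>k\<in>?D \<inter> N. ?g k)"
    by (intro sum_mono) auto
  also have "\<dots> \<le> (\<Sum>k\<in>N. ?g k)"
    using assms(2) g_nonneg by (intro sum_mono2) auto
  finally show ?thesis by (simp add: r_def)
qed

text \<open>
  Each term has expectation at most \<open>w\<^sub>j * \<alpha> j / K\<close>: the thresholds \<open>\<alpha> j / K\<close> lie strictly between
  \<open>0\<close> and \<open>1\<close>, where the defining inequality of a p-variable applies.
\<close>

lemma p_variable_expectation_bound:
  fixes K :: nat
  assumes "prob_space M" and X: "p_variable M X" and \<alpha>: "0 < \<alpha>" "\<alpha> < 1"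
  defines "g \<equiv> \<lambda>\<omega>. \<Sum>j=1..K. reciprocal_decrement K j * of_bool (X \<omega> \<le> \<alpha> * real j / real K)"
  shows "integrable M g"
    and "integral\<^sup>L M g \<le> (\<Sum>j=1..K. 1 / real j) * \<alpha> / real K"
proof -
  interpret prob_space M by fact
  have Xm [measurable]: "X \<in> borel_measurable M"
    using X by (simp add: p_variable_def)
  define A where "A j = {\<omega> \<in> space M. X \<omega> \<le> \<alpha> * real j / real K}" for j
  have A [measurable]: "A j \<in> sets M" for j
    unfolding A_def by measurable
  have int: "integrable M (\<lambda>\<omega>. \<Sum>j=1..K. reciprocal_decrement K j * indicator (A j) \<omega> :: real)"
    by (intro Bochner_Integration.integrable_sum integrable_mult_right) (simp add: emeasure_eq_measure)
  have eq: "g \<omega> = (\<Sum>j=1..K. reciprocal_decrement K j * indicator (A j) \<omega>)" if "\<omega> \<in> space M" for \<omega>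
    unfolding g_def using that by (intro sum.cong) (auto simp: A_def indicator_def)
  show "integrable M g"
    using int by (subst Bochner_Integration.integrable_cong[OF refl eq])
  have prob_A: "prob (A j) \<le> \<alpha> * real j / real K" if j: "j \<in> {1..K}" for j
  proof -
    have "\<alpha> * real j \<le> \<alpha> * real K"
      using j \<alpha> by (intro mult_left_mono) auto
    also have "\<dots> < real K" using j \<alpha> by auto
    finally have "\<alpha> * real j / real K \<in> {0<..<1}"
      using j \<alpha> by auto
    then show ?thesis using X unfolding p_variable_def A_def by blast
  qed
  have "integral\<^sup>L M g = (\<integral>\<omega>. (\<Sum>j=1..K. reciprocal_decrement K j * indicator (A j) \<omega>) \<partial>M)"
    by (rule Bochner_Integration.integral_cong[OF refl eq])
  also have "\<dots> = (\<Sum>j=1..K. reciprocal_decrement K j * prob (A j))"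
    by (subst Bochner_Integration.integral_sum) (auto simp: emeasure_eq_measure)
  also have "\<dots> \<le> (\<Sum>j=1..K. reciprocal_decrement K j * (\<alpha> * real j / real K))"
    by (intro sum_mono mult_left_mono prob_A reciprocal_decrement_nonneg) auto
  also have "\<dots> = (\<Sum>j=1..K. real j * reciprocal_decrement K j) * \<alpha> / real K"
    unfolding sum_distrib_right sum_divide_distrib by (intro sum.cong) auto
  finally show "integral\<^sup>L M g \<le> (\<Sum>j=1..K. 1 / real j) * \<alpha> / real K"
    by (simp only: reciprocal_decrement_weighted_sum)
qed

theorem theorem4:
  fixes M :: "'a measure"
    and P :: "nat \<Rightarrow> 'a \<Rightarrow> real"
    and K :: nat and N :: "nat set" and \<alpha> :: real
  assumes "prob_space M"
    and "K \<ge> 1"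
    and "N \<subseteq> {1..K}"
    and "\<And>k. k \<in> {1..K} \<Longrightarrow> P k \<in> borel_measurable M"
    and "\<And>k \<omega>. k \<in> {1..K} \<Longrightarrow> \<omega> \<in> space M \<Longrightarrow> 0 \<le> P k \<omega>"
    and "\<And>k. k \<in> N \<Longrightarrow> p_variable M (P k)"
    and "0 < \<alpha>" and "\<alpha> < 1"
  shows "FDR M N (benjamini_hochberg K \<alpha>) P
           \<le> (\<Sum>k=1..K. 1 / real k) * \<alpha> * real (card N) / real K"
proof -
  define g where "g k \<omega> =
    (\<Sum>j=1..K. reciprocal_decrement K j * of_bool (P k \<omega> \<le> \<alpha> * real j / real K))" for k \<omega>
  have finN: "finite N"
    by (rule finite_subset[OF assms(3)]) simp
  note bound = p_variable_expectation_bound[OF assms(1) assms(6) assms(7,8), of _ K, folded g_def]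
  have "FDR M N (benjamini_hochberg K \<alpha>) P \<le> (\<integral>\<omega>. (\<Sum>k\<in>N. g k \<omega>) \<partial>M)"
    unfolding FDR_def
    \<comment> \<open>The rule asks for integrability of the dominating function alone: a non-integrable left-hand
      side would have the default integral \<open>0\<close>.\<close>
  proof (rule integral_mono')
    show "integrable M (\<lambda>\<omega>. \<Sum>k\<in>N. g k \<omega>)"
      by (intro Bochner_Integration.integrable_sum bound(1))
  next
    fix \<omega>
    show "real (card (benjamini_hochberg K \<alpha> (\<lambda>k. P k \<omega>) \<inter> N))
          / real (max (card (benjamini_hochberg K \<alpha> (\<lambda>k. P k \<omega>))) 1) \<le> (\<Sum>k\<in>N. g k \<omega>)"
      unfolding g_def using assms(7) finN by (intro false_discovery_proportion_le) auto
    show "0 \<le> (\<Sum>k\<in>N. g k \<omega>)"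
      unfolding g_def
      by (intro sum_nonneg mult_nonneg_nonneg reciprocal_decrement_nonneg) auto
  qed
  also have "\<dots> = (\<Sum>k\<in>N. integral\<^sup>L M (g k))"
    by (rule Bochner_Integration.integral_sum) (rule bound(1))
  also have "\<dots> \<le> (\<Sum>k\<in>N. (\<Sum>j=1..K. 1 / real j) * \<alpha> / real K)"
    by (intro sum_mono bound(2))
  also have "\<dots> = (\<Sum>k=1..K. 1 / real k) * \<alpha> * real (card N) / real K"
    by simp
  finally show ?thesis .
qed

end
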